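(* A specific RLSE $(R,+,\cdot,0,1)$ is a Boolean ring if and only if $x(y+1)=xy+x$ for all $x,y\in R$.
   Context: A ring-like structure of events (RLSE) is an algebra $(R,+,\cdot,0,1)$ of type $(2,2,0,0)$ such that $(R,\cdot,0,1)$ is a bounded meet-semilattice (i.e. $\cdot$ is associative, commutative and idempotent, $x0=0$ and $x1=x$ for all $x$) and the following hold for all $x,y\in R$ (multiplication binds more strongly than addition): (R1) $x+y=y+x$; (R2) $(xy+1)(x+1)+1=x$; (R3) $\big((xy+1)x+1\big)x=xy$; (R4) $xy+(x+1)=(xy+1)x+1$. An RLSE is called specific if in addition (R5) $x+y=x(y+1)+(x+1)y$ for all $x,y\in R$. A Boolean ring is a ring $(R,+,\cdot,0,1)$ with unit $1$ in which $xx=x$ for all $x$. *)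

theory Defs
  imports "HOL-Algebra.Ring"
begin

text \<open>
  The algebra is rendered as a record in the sense of HOL-Algebra. The bounded meet-semilattice
  reduct is a commutative monoid (providing closure, associativity, commutativity and
  \<open>x \<otimes> \<one> = x\<close>) that is idempotent and in which \<open>\<zero>\<close> is absorbing.
  No property of \<open>\<oplus>\<close> is taken from the ring hierarchy beyond the signature, and
  \<open>\<zero> = \<one>\<close> is allowed.
\<close>

locale rlse = comm_monoid R for R :: "('a, 'm) ring_scheme" (structure) +
  assumes zero_in_carrier: "\<zero> \<in> carrier R"
    and add_in_carrier: "\<lbrakk>x \<in> carrier R; y \<in> carrier R\<rbrakk> \<Longrightarrow> x \<oplus> y \<in> carrier R"
    and mult_idem: "x \<in> carrier R \<Longrightarrow> x \<otimes> x = x"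
    and mult_zero: "x \<in> carrier R \<Longrightarrow> x \<otimes> \<zero> = \<zero>"
    and R1: "\<lbrakk>x \<in> carrier R; y \<in> carrier R\<rbrakk> \<Longrightarrow> x \<oplus> y = y \<oplus> x"
    and R2: "\<lbrakk>x \<in> carrier R; y \<in> carrier R\<rbrakk> \<Longrightarrow>
               (x \<otimes> y \<oplus> \<one>) \<otimes> (x \<oplus> \<one>) \<oplus> \<one> = x"
    and R3: "\<lbrakk>x \<in> carrier R; y \<in> carrier R\<rbrakk> \<Longrightarrow>
               ((x \<otimes> y \<oplus> \<one>) \<otimes> x \<oplus> \<one>) \<otimes> x = x \<otimes> y"
    and R4: "\<lbrakk>x \<in> carrier R; y \<in> carrier R\<rbrakk> \<Longrightarrow>
               x \<otimes> y \<oplus> (x \<oplus> \<one>) = (x \<otimes> y \<oplus> \<one>) \<otimes> x \<oplus> \<one>"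

locale specific_rlse = rlse +
  assumes R5: "\<lbrakk>x \<in> carrier R; y \<in> carrier R\<rbrakk> \<Longrightarrow>
                 x \<oplus> y = x \<otimes> (y \<oplus> \<one>) \<oplus> (x \<oplus> \<one>) \<otimes> y"

locale boolean_ring = ring +
  assumes idem: "x \<in> carrier R \<Longrightarrow> x \<otimes> x = x"

end

theory Submission
  imports Defs
begin

text \<open>
  Every RLSE is an orthomodular lattice with complement \<open>x \<oplus> \<one>\<close>, in which the sum of two
  orthogonal elements is their join. In a specific RLSE the condition
  \<open>x \<otimes> (y \<oplus> \<one>) = x \<otimes> y \<oplus> x\<close> reads
  \<open>x \<and> y' = x \<and> (x \<and> y)'\<close>; applying it three times inside \<open>x \<and> (a' \<and> b')'\<close>
  shows that meets distribute over orthogonal joins, hence over the symmetric difference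
  \<open>\<oplus>\<close>. Associativity of \<open>\<oplus>\<close> then follows by comparing the two sides
  below \<open>z\<close> and below its complement.
\<close>

context rlse
begin

abbreviation neg :: "'a \<Rightarrow> 'a" where
  "neg x \<equiv> x \<oplus> \<one>"

lemmas closed [simp, intro] = zero_in_carrier add_in_carrier

lemma neg_neg [simp]: "x \<in> carrier R \<Longrightarrow> neg (neg x) = x"
  using R2[of x \<one>] by (simp add: mult_idem)

text \<open>Since \<open>\<zero>\<close> is absorbing, R2 at \<open>neg \<one>\<close> and
  \<open>\<zero>\<close> collapses to \<open>\<zero> = neg \<one>\<close>; complementing once more
  gives the claim.\<close>

lemma neg_zero [simp]: "neg \<zero> = \<one>"
  using R2[of "neg \<one>" \<zero>] neg_neg[of "neg \<zero>"] by (simp add: mult_zero)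

lemma neg_one [simp]: "neg \<one> = \<zero>"
  using neg_neg[of \<zero>] by simp

lemma zero_mult [simp]: "x \<in> carrier R \<Longrightarrow> \<zero> \<otimes> x = \<zero>"
  using mult_zero m_comm by simp

lemma zero_add [simp]: "x \<in> carrier R \<Longrightarrow> \<zero> \<oplus> x = x"
  using R4[of "neg x" \<zero>] by (simp add: mult_zero)

lemma add_zero [simp]: "x \<in> carrier R \<Longrightarrow> x \<oplus> \<zero> = x"
  using R1[of x \<zero>] by simp

lemma neg_mult_self [simp]: "x \<in> carrier R \<Longrightarrow> neg x \<otimes> x = \<zero>"
  using R3[of x \<zero>] by (simp add: mult_zero)

lemma mult_neg_self [simp]: "x \<in> carrier R \<Longrightarrow> x \<otimes> neg x = \<zero>"
  by (simp add: m_comm[of x])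

lemma add_neg [simp]: "x \<in> carrier R \<Longrightarrow> x \<oplus> neg x = \<one>"
  using R4[of x \<one>] by simp

lemma neg_mult_neg_absorb:
  assumes "x \<in> carrier R" "y \<in> carrier R"
  shows "neg (x \<otimes> y) \<otimes> neg x = neg x"
proof -
  have "neg (neg (neg (x \<otimes> y) \<otimes> neg x)) = neg x"
    using R2[OF assms] by simp
  thus ?thesis using assms by simp
qed

text \<open>The semilattice order is written as \<open>x \<otimes> y = x\<close>; \<open>x\<close>
  is then the product \<open>y \<otimes> x\<close>, so R2 in its absorbed form applies.\<close>

lemma neg_antimono:
  assumes "x \<in> carrier R" "y \<in> carrier R" "x \<otimes> y = x"
  shows "neg x \<otimes> neg y = neg y"
  using neg_mult_neg_absorb[of y x] assms m_comm[of x y] by simp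

text \<open>This is R4 at \<open>neg b\<close> and \<open>a\<close>, where orthogonality turns
  \<open>neg b \<otimes> a\<close> into \<open>a\<close>; the right side is the De Morgan
  join.\<close>

lemma add_orthogonal:
  assumes "a \<in> carrier R" "b \<in> carrier R" "a \<otimes> neg b = a"
  shows "a \<oplus> b = neg (neg a \<otimes> neg b)"
  using R4[of "neg b" a] assms m_comm[of a "neg b"] by simp

text \<open>By antitonicity \<open>neg x\<close> lies below \<open>neg a\<close> and
  \<open>neg b\<close>, hence below their meet; complementing reverses this.\<close>

lemma join_least:
  assumes "a \<in> carrier R" "b \<in> carrier R" "x \<in> carrier R" "a \<otimes> x = a" "b \<otimes> x = b"
  shows "neg (neg a \<otimes> neg b) \<otimes> x = neg (neg a \<otimes> neg b)"
proof -
  have "neg x \<otimes> (neg a \<otimes> neg b) = neg x"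
    using neg_antimono[of a x] neg_antimono[of b x] assms
    by (metis add_in_carrier m_assoc m_comm one_closed)
  from neg_antimono[OF _ _ this] show ?thesis
    using assms m_comm[of x] by simp
qed

end

locale specific_rlse_sub = specific_rlse +
  assumes mult_neg: "\<lbrakk>x \<in> carrier R; y \<in> carrier R\<rbrakk> \<Longrightarrow> x \<otimes> neg y = x \<otimes> y \<oplus> x"
begin

text \<open>By \<open>mult_neg\<close> both sides equal \<open>x \<otimes> y \<oplus> x\<close>,
  because \<open>x\<close> is absorbed by \<open>x \<otimes> y\<close>.\<close>

lemma mult_neg_mult:
  assumes "x \<in> carrier R" "y \<in> carrier R"
  shows "x \<otimes> neg (x \<otimes> y) = x \<otimes> neg y"
  using mult_neg[of x "x \<otimes> y"] mult_neg[OF assms] assms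
  by (simp add: m_assoc[symmetric] mult_idem)

lemma mult_mult_neg_mult:
  assumes "x \<in> carrier R" "p \<in> carrier R" "q \<in> carrier R"
  shows "(x \<otimes> p) \<otimes> neg (x \<otimes> q) = x \<otimes> (p \<otimes> neg q)"
proof -
  have "(x \<otimes> p) \<otimes> neg (x \<otimes> q) = p \<otimes> (x \<otimes> neg (x \<otimes> q))"
    using assms by (simp add: m_assoc m_lcomm)
  also have "\<dots> = p \<otimes> (x \<otimes> neg q)"
    using assms by (simp add: mult_neg_mult)
  also have "\<dots> = x \<otimes> (p \<otimes> neg q)"
    using assms by (simp add: m_lcomm)
  finally show ?thesis .
qed

lemma mult_add_orthogonal:
  assumes x: "x \<in> carrier R" and a: "a \<in> carrier R" and b: "b \<in> carrier R"
    and ab: "a \<otimes> neg b = a"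
  shows "x \<otimes> (a \<oplus> b) = x \<otimes> a \<oplus> x \<otimes> b"
proof -
  note c = x a b
  \<comment> \<open>\<open>neg ?u\<close> is the join of \<open>x \<otimes> a\<close> and
    \<open>x \<otimes> b\<close>. Below \<open>x\<close>, \<open>?u\<close> agrees with the
    complement of the join of \<open>a\<close> and \<open>b\<close>.\<close>
  let ?u = "neg (x \<otimes> a) \<otimes> neg (x \<otimes> b)"
  have "x \<otimes> ?u = (x \<otimes> neg (x \<otimes> a)) \<otimes> neg (x \<otimes> b)"
    using c by (simp add: m_assoc)
  also have "\<dots> = x \<otimes> (neg a \<otimes> neg b)"
    using c by (simp add: mult_neg_mult mult_mult_neg_mult)
  finally have u: "x \<otimes> ?u = x \<otimes> (neg a \<otimes> neg b)" .
  have orth: "(x \<otimes> a) \<otimes> neg (x \<otimes> b) = x \<otimes> a"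
    using c ab by (simp add: mult_mult_neg_mult)
  have le: "(x \<otimes> y) \<otimes> x = x \<otimes> y" if "y \<in> carrier R" for y
    using x that by (metis m_assoc m_comm mult_idem)
  have "x \<otimes> (a \<oplus> b) = x \<otimes> neg (neg a \<otimes> neg b)"
    using add_orthogonal[OF a b ab] by simp
  also have "\<dots> = x \<otimes> neg (x \<otimes> ?u)"
    unfolding u using c by (simp add: mult_neg_mult)
  also have "\<dots> = neg ?u \<otimes> x"
    using c by (simp add: mult_neg_mult m_comm)
  also have "\<dots> = neg ?u"
    using join_least[of "x \<otimes> a" "x \<otimes> b" x] c le by simp
  also have "\<dots> = x \<otimes> a \<oplus> x \<otimes> b"
    using add_orthogonal[OF _ _ orth] c by simp
  finally show ?thesis .
qed

lemma mult_add:
  assumes "x \<in> carrier R" "y \<in> carrier R" "z \<in> carrier R"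
  shows "x \<otimes> (y \<oplus> z) = x \<otimes> y \<oplus> x \<otimes> z"
proof -
  \<comment> \<open>The two summands of R5 are orthogonal: \<open>y \<otimes> neg z\<close> lies
    below \<open>y\<close>, which lies below \<open>neg (neg y \<otimes> z)\<close>.\<close>
  have "neg (neg y \<otimes> z) \<otimes> neg (neg y) = neg (neg y)"
    using neg_mult_neg_absorb[of "neg y" z] assms by simp
  hence *: "neg (neg y \<otimes> z) \<otimes> y = y"
    using assms by simp
  have "(y \<otimes> neg z) \<otimes> neg (neg y \<otimes> z) = (neg (neg y \<otimes> z) \<otimes> y) \<otimes> neg z"
    using assms by (simp add: m_ac)
  hence orth: "(y \<otimes> neg z) \<otimes> neg (neg y \<otimes> z) = y \<otimes> neg z"
    unfolding * .
  have "x \<otimes> (y \<oplus> z) = x \<otimes> (y \<otimes> neg z \<oplus> neg y \<otimes> z)"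
    by (simp only: R5[OF assms(2,3)])
  also have "\<dots> = x \<otimes> (y \<otimes> neg z) \<oplus> x \<otimes> (neg y \<otimes> z)"
    using assms orth by (intro mult_add_orthogonal) auto
  \<comment> \<open>Moving \<open>x\<close> inside the complements yields the R5 expansion of the
    desired sum.\<close>
  also have "\<dots> = (x \<otimes> y) \<otimes> neg (x \<otimes> z) \<oplus> (x \<otimes> z) \<otimes> neg (x \<otimes> y)"
    using assms by (simp add: mult_mult_neg_mult m_comm[of "neg y" z])
  also have "\<dots> = (x \<otimes> y) \<otimes> neg (x \<otimes> z) \<oplus> neg (x \<otimes> y) \<otimes> (x \<otimes> z)"
    using assms by (simp only: m_comm[of "x \<otimes> z" "neg (x \<otimes> y)"] m_closed closed one_closed)
  also have "\<dots> = x \<otimes> y \<oplus> x \<otimes> z"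
    using assms by (intro R5[symmetric]) auto
  finally show ?thesis .
qed

lemma add_mult:
  assumes "x \<in> carrier R" "y \<in> carrier R" "z \<in> carrier R"
  shows "(x \<oplus> y) \<otimes> z = x \<otimes> z \<oplus> y \<otimes> z"
  using mult_add[of z x y] assms by (simp add: m_comm)

text \<open>Distributivity over \<open>z \<oplus> neg z = \<one>\<close> recovers every element from
  its meets with \<open>z\<close> and \<open>neg z\<close>.\<close>

lemma eq_by_parts:
  assumes "p \<in> carrier R" "q \<in> carrier R" "z \<in> carrier R"
    and "z \<otimes> p = z \<otimes> q" "neg z \<otimes> p = neg z \<otimes> q"
  shows "p = q"
proof -
  have "w = z \<otimes> w \<oplus> neg z \<otimes> w" if "w \<in> carrier R" for w
    using add_mult[of z "neg z" w] assms(3) that by simp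
  thus ?thesis using assms by metis
qed

lemma mult_add_self:
  assumes "z \<in> carrier R" "p \<in> carrier R"
  shows "z \<otimes> p \<oplus> z = z \<otimes> neg p"
  using mult_neg assms by simp

text \<open>This case of associativity, with third summand \<open>\<one>\<close>, is needed for the
  part below \<open>z\<close> in \<open>add_assoc\<close>. Below \<open>y\<close> both sides reduce
  to \<open>y \<otimes> x\<close>.\<close>

lemma neg_add:
  assumes x: "x \<in> carrier R" and y: "y \<in> carrier R"
  shows "neg (x \<oplus> y) = x \<oplus> neg y"
proof (rule eq_by_parts[of _ _ y])
  have "y \<otimes> (x \<oplus> y) = y \<otimes> neg x"
    using x y by (simp add: mult_add mult_idem mult_neg)
  hence "y \<otimes> neg (x \<oplus> y) = y \<otimes> neg x \<oplus> y"
    using x y by (simp add: mult_neg)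
  also have "\<dots> = y \<otimes> x"
    using x y mult_add_self[of y "neg x"] by simp
  finally show "y \<otimes> neg (x \<oplus> y) = y \<otimes> (x \<oplus> neg y)"
    using x y mult_add[of y x "neg y"] by simp
  have "neg y \<otimes> (x \<oplus> y) = neg y \<otimes> x"
    using x y mult_add[of "neg y" x y] by simp
  hence "neg y \<otimes> neg (x \<oplus> y) = neg y \<otimes> x \<oplus> neg y"
    using x y mult_neg[of "neg y" "x \<oplus> y"] by simp
  also have "\<dots> = neg y \<otimes> (x \<oplus> neg y)"
    using x y mult_add[of "neg y" x "neg y"] mult_idem[of "neg y"] by simp
  finally show "neg y \<otimes> neg (x \<oplus> y) = neg y \<otimes> (x \<oplus> neg y)" .
qed (use x y in auto)

lemma add_assoc:
  assumes x: "x \<in> carrier R" and y: "y \<in> carrier R" and z: "z \<in> carrier R"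
  shows "(x \<oplus> y) \<oplus> z = x \<oplus> (y \<oplus> z)"
proof (rule eq_by_parts[of _ _ z])
  note c = x y z
  have "z \<otimes> ((x \<oplus> y) \<oplus> z) = z \<otimes> neg (x \<oplus> y)"
    using c mult_add[of z "x \<oplus> y" z] mult_add_self[of z "x \<oplus> y"] mult_idem by simp
  also have "\<dots> = z \<otimes> x \<oplus> z \<otimes> neg y"
    using c neg_add[OF x y] mult_add[of z x "neg y"] by simp
  also have "\<dots> = z \<otimes> (x \<oplus> (y \<oplus> z))"
    using c mult_add[of z x "y \<oplus> z"] mult_add[of z y z] mult_add_self[of z y] mult_idem by simp
  finally show "z \<otimes> ((x \<oplus> y) \<oplus> z) = z \<otimes> (x \<oplus> (y \<oplus> z))" .
  \<comment> \<open>Here \<open>z\<close> contributes \<open>\<zero>\<close>, so both sides become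
    \<open>neg z \<otimes> x \<oplus> neg z \<otimes> y\<close>.\<close>
  show "neg z \<otimes> ((x \<oplus> y) \<oplus> z) = neg z \<otimes> (x \<oplus> (y \<oplus> z))"
    using c mult_add[of "neg z" "x \<oplus> y" z] mult_add[of "neg z" x y]
      mult_add[of "neg z" x "y \<oplus> z"] mult_add[of "neg z" y z] by simp
qed (use x y z in auto)

text \<open>Supplies additive inverses: \<open>mult_neg\<close> with both arguments \<open>x\<close>
  has left side \<open>\<zero>\<close>.\<close>

lemma add_self: "x \<in> carrier R \<Longrightarrow> x \<oplus> x = \<zero>"
  using mult_neg[of x x] by (simp add: mult_idem)

lemma boolean_ring: "boolean_ring R"
proof -
  have "abelian_group R"
  proof (rule abelian_groupI)
    fix x y assume "x \<in> carrier R" "y \<in> carrier R"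
    thus "x \<oplus> y = y \<oplus> x" by (rule R1)
  qed (auto simp: add_assoc intro: add_self)
  then interpret ring R
    by (rule ringI) (auto simp: add_mult mult_add monoid_axioms)
  show ?thesis
    by unfold_locales (rule mult_idem)
qed

end

theorem corollary2p8:
  fixes R :: "('a, 'm) ring_scheme" (structure)
  assumes "specific_rlse R"
  shows "boolean_ring R \<longleftrightarrow>
    (\<forall>x\<in>carrier R. \<forall>y\<in>carrier R. x \<otimes> (y \<oplus> \<one>) = x \<otimes> y \<oplus> x)"
proof
  assume "boolean_ring R"
  then interpret boolean_ring R .
  show "\<forall>x\<in>carrier R. \<forall>y\<in>carrier R. x \<otimes> (y \<oplus> \<one>) = x \<otimes> y \<oplus> x"
    by (simp add: r_distr)
next
  assume "\<forall>x\<in>carrier R. \<forall>y\<in>carrier R. x \<otimes> (y \<oplus> \<one>) = x \<otimes> y \<oplus> x"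
  with assms have "specific_rlse_sub R"
    by (simp add: specific_rlse_sub_def specific_rlse_sub_axioms_def)
  thus "boolean_ring R"
    by (rule specific_rlse_sub.boolean_ring)
qed

end
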